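(* Let $a\in\mathbb{R}^n_{>0}$, $b\in\mathbb{R}^n$, and $\beta\in\{\text{Box},\text{GBC},\text{NC},\text{LC},\text{SC}\}$, with the parameters defining the constraints $\beta$ fixed. Let $\bar f:\mathbb{R}\to\mathbb{R}$ be a strictly convex function and let $f:\mathbb{R}\to\mathbb{R}$ be an arbitrary convex function. If $x$ is optimal for $(a,b,\bar f)$-S/$\beta$/C, then $x$ is also optimal for $(a,b,f)$-S/$\beta$/C.
   Context: Let $\mathcal{N}=\{1,\ldots,n\}$, $\mathcal{M}=\{1,\ldots,m\}$ and $R\in\mathbb{R}$. For a convex function $g:\mathbb{R}\to\mathbb{R}$, the problem $(a,b,g)$-S/$\beta$/C is to minimize $\sum_{i\in\mathcal{N}} a_i g\left(\frac{x_i}{a_i}+b_i\right)$ over $x\in\mathbb{R}^n$ subject to $\sum_{i\in\mathcal{N}}x_i=R$ and the constraints $\beta$. The two problems in the claim have the same constraints (same constraint parameters). Constraint types $\beta$: - Box: $l_i\le x_i\le u_i$ for all $i\in\mathcal{N}$. - GBC (generalized bound constraints): box constraints together with $L_j\le\sum_{i\in\mathcal{N}_j}x_i\le U_j$, $j\in\mathcal{M}$, where $\mathcal{N}_1,\ldots,\mathcal{N}_m$ form a partition of $\mathcal{N}$. - NC (nested constraints): box constraints together with $L_j\le\sum_{i\in\mathcal{N}_j}x_i\le U_j$, $j\in\mathcal{M}$, where $\mathcal{N}_1\subset\cdots\subset\mathcal{N}_m\subset\mathcal{N}$. - LC (laminar constraints): $L_j\le\sum_{i\in\mathcal{N}_j}x_i\le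 U_j$, $j\in\mathcal{M}$, where the subsets $\mathcal{N}_1,\ldots,\mathcal{N}_m$ of $\mathcal{N}$ are such that for all $j,\ell\in\mathcal{M}$, if $\mathcal{N}_j\cap\mathcal{N}_\ell\ne\emptyset$ then $\mathcal{N}_j\subset\mathcal{N}_\ell$ or $\mathcal{N}_j\supset\mathcal{N}_\ell$. - SC (submodular constraints): $\sum_{i\in\mathcal{S}}x_i\le r(\mathcal{S})$ for $\mathcal{S}\subset\mathcal{N}$ and $\sum_{i\in\mathcal{N}}x_i=r(\mathcal{N})$, where $r:2^{\mathcal{N}}\to\mathbb{R}$ is submodular, i.e. $r(\mathcal{X}\cup\mathcal{Y})+r(\mathcal{X}\cap\mathcal{Y})\le r(\mathcal{X})+r(\mathcal{Y})$ for all $\mathcal{X},\mathcal{Y}\subseteq\mathcal{N}$, with $r(\emptyset)=0$ and $r(\mathcal{N})=R$. *)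

theory Defs
  imports "HOL-Analysis.Analysis"
begin

definition strictly_convex_on :: "'a::real_vector set \<Rightarrow> ('a \<Rightarrow> real) \<Rightarrow> bool" where
  "strictly_convex_on S f \<longleftrightarrow> convex S \<and>
     (\<forall>x\<in>S. \<forall>y\<in>S. \<forall>u>0. \<forall>v>0. x \<noteq> y \<longrightarrow> u + v = 1 \<longrightarrow>
        f (u *\<^sub>R x + v *\<^sub>R y) < u * f x + v * f y)"

definition submodular :: "('n set \<Rightarrow> real) \<Rightarrow> bool" where
  "submodular r \<longleftrightarrow> (\<forall>X Y. r (X \<union> Y) + r (X \<inter> Y) \<le> r X + r Y)"

(* The library's partition_on speaks about a set of sets; inj_on makes an indexed family
   N 1, ..., N m list every block exactly once. *)
definition partition_family :: "nat \<Rightarrow> (nat \<Rightarrow> 'n set) \<Rightarrow> bool" where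
  "partition_family m N \<longleftrightarrow> partition_on UNIV (N ` {1..m}) \<and> inj_on N {1..m}"

definition nested_family :: "nat \<Rightarrow> (nat \<Rightarrow> 'n set) \<Rightarrow> bool" where
  "nested_family m N \<longleftrightarrow> (\<forall>j\<in>{1..<m}. N j \<subseteq> N (Suc j))"

definition laminar_family :: "nat \<Rightarrow> (nat \<Rightarrow> 'n set) \<Rightarrow> bool" where
  "laminar_family m N \<longleftrightarrow>
     (\<forall>j\<in>{1..m}. \<forall>k\<in>{1..m}. N j \<inter> N k \<noteq> {} \<longrightarrow> N j \<subseteq> N k \<or> N k \<subseteq> N j)"

(* A constraint type together with its parameters. The ground set is the finite type 'n.
   Arguments: Box l u, GBC l u m N L U, NC l u m N L U, LC m N L U and SC r, where the
   families N, L, U are only relevant on the index set {1..m}. *)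
datatype ('n::finite) constraints =
    Box "real ^ 'n" "real ^ 'n"
  | GBC "real ^ 'n" "real ^ 'n" nat "nat \<Rightarrow> 'n set" "nat \<Rightarrow> real" "nat \<Rightarrow> real"
  | NC "real ^ 'n" "real ^ 'n" nat "nat \<Rightarrow> 'n set" "nat \<Rightarrow> real" "nat \<Rightarrow> real"
  | LC nat "nat \<Rightarrow> 'n set" "nat \<Rightarrow> real" "nat \<Rightarrow> real"
  | SC "'n set \<Rightarrow> real"

(* The standing assumptions on the parameters of each constraint type. *)
fun admissible :: "real \<Rightarrow> ('n::finite) constraints \<Rightarrow> bool" where
  "admissible R (Box l u) \<longleftrightarrow> True"
| "admissible R (GBC l u m N L U) \<longleftrightarrow> partition_family m N"
| "admissible R (NC l u m N L U) \<longleftrightarrow> nested_family m N"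
| "admissible R (LC m N L U) \<longleftrightarrow> laminar_family m N"
| "admissible R (SC r) \<longleftrightarrow> submodular r \<and> r {} = 0 \<and> r UNIV = R"

definition box_bounds :: "real ^ 'n \<Rightarrow> real ^ 'n \<Rightarrow> real ^ ('n::finite) \<Rightarrow> bool" where
  "box_bounds l u x \<longleftrightarrow> (\<forall>i. l $ i \<le> x $ i \<and> x $ i \<le> u $ i)"

definition group_bounds ::
  "nat \<Rightarrow> (nat \<Rightarrow> 'n set) \<Rightarrow> (nat \<Rightarrow> real) \<Rightarrow> (nat \<Rightarrow> real) \<Rightarrow> real ^ ('n::finite) \<Rightarrow> bool" where
  "group_bounds m N L U x \<longleftrightarrow>
     (\<forall>j\<in>{1..m}. L j \<le> (\<Sum>i\<in>N j. x $ i) \<and> (\<Sum>i\<in>N j. x $ i) \<le> U j)"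

fun satisfies :: "('n::finite) constraints \<Rightarrow> real ^ 'n \<Rightarrow> bool" where
  "satisfies (Box l u) x \<longleftrightarrow> box_bounds l u x"
| "satisfies (GBC l u m N L U) x \<longleftrightarrow> box_bounds l u x \<and> group_bounds m N L U x"
| "satisfies (NC l u m N L U) x \<longleftrightarrow> box_bounds l u x \<and> group_bounds m N L U x"
| "satisfies (LC m N L U) x \<longleftrightarrow> group_bounds m N L U x"
| "satisfies (SC r) x \<longleftrightarrow>
     (\<forall>S. (\<Sum>i\<in>S. x $ i) \<le> r S) \<and> (\<Sum>i\<in>UNIV. x $ i) = r UNIV"

definition feasible :: "real \<Rightarrow> ('n::finite) constraints \<Rightarrow> real ^ 'n \<Rightarrow> bool" where
  "feasible R \<beta> x \<longleftrightarrow> (\<Sum>i\<in>UNIV. x $ i) = R \<and> satisfies \<beta> x"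

definition objective ::
  "real ^ 'n \<Rightarrow> real ^ 'n \<Rightarrow> (real \<Rightarrow> real) \<Rightarrow> real ^ ('n::finite) \<Rightarrow> real" where
  "objective a b g x = (\<Sum>i\<in>UNIV. a $ i * g (x $ i / a $ i + b $ i))"

(* Optimality for the separable resource allocation problem (a,b,g)-S/\<beta>/C. *)
definition optimal ::
  "real ^ 'n \<Rightarrow> real ^ 'n \<Rightarrow> (real \<Rightarrow> real) \<Rightarrow> real \<Rightarrow> 'n constraints \<Rightarrow> real ^ ('n::finite) \<Rightarrow> bool" where
  "optimal a b g R \<beta> x \<longleftrightarrow> is_arg_min (objective a b g) (feasible R \<beta>) x"

end

theory Submission
  imports Defs
begin

text \<open>
  Put \<open>t i = x i / a i + b i\<close>. If \<open>t i < t j\<close>, strict convexity makes moving a little mass from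
  \<open>j\<close> to \<open>i\<close> an improvement, so optimality of \<open>x\<close> for \<open>fbar\<close> says that every such move is
  infeasible. This condition no longer mentions \<open>fbar\<close>. Each of the feasible sets has the
  exchange property: if the moves out of \<open>A\<close> are all infeasible at \<open>x\<close>, then \<open>x\<close> minimises the mass
  of \<open>A\<close>. For submodular constraints this comes from the lattice of tight sets; the
  other four types are bounds on a laminar family, where a minimal member into which \<open>A\<close> and its
  complement are imbalanced in opposite directions contains a feasible move. Applying it to the
  upper level sets of \<open>t\<close> and summing over levels shows that a subgradient of the objective for
  \<open>f\<close> at \<open>x\<close> is nonnegative in every feasible direction.
\<close>

subsection \<open>Subgradients and level sets\<close>

text \<open>Adding the subgradient inequalities at two points gives monotonicity, which later orders
  the level sets of \<open>\<sigma>\<close> like those of its argument.\<close>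

lemma convex_on_UNIV_subgradient:
  fixes f :: "real \<Rightarrow> real"
  assumes "convex_on UNIV f"
  obtains \<sigma> where "mono \<sigma>" and "\<And>t u. f t + \<sigma> t * (u - t) \<le> f u"
proof -
  \<comment> \<open>The infimum of the secant slopes to the right of \<open>t\<close>, i.e. the
    right derivative of \<open>f\<close>.\<close>
  define \<sigma> where "\<sigma> t = Inf ((\<lambda>u. (f t - f u) / (t - u)) ` ({t<..} \<inter> UNIV))" for t
  have sub: "f t + \<sigma> t * (u - t) \<le> f u" for t u
    using convex_le_Inf_differential[OF assms, of t u] by (simp add: \<sigma>_def)
  have "\<sigma> t \<le> \<sigma> u" if "t < u" for t u
  proof -
    have "0 \<le> (\<sigma> u - \<sigma> t) * (u - t)"
      using sub[of t u] sub[of u t] by (simp add: algebra_simps)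
    with that show ?thesis
      by (simp add: zero_le_mult_iff)
  qed
  then have "mono \<sigma>"
    by (metis (no_types) monoI order_le_less order_refl)
  with sub show ?thesis
    using that by blast
qed

text \<open>Abel summation: \<open>s\<close> is a constant plus a positive combination of indicators
  of its upper level sets, and the constant contributes nothing because \<open>d\<close> sums to
  zero. The induction removes the largest value of \<open>s\<close>.\<close>

lemma sum_mult_nonneg_if_upper_levels:
  fixes s d :: "'a \<Rightarrow> real"
  assumes "finite I" "sum d I = 0"
    and "\<And>c. 0 \<le> (\<Sum>i\<in>{i\<in>I. c \<le> s i}. d i)"
  shows "0 \<le> (\<Sum>i\<in>I. s i * d i)"
  using assms(3)
proof (induction "card (s ` I)" arbitrary: s rule: less_induct)
  case less
  show ?case
  proof (cases "\<exists>c. \<forall>i\<in>I. s i = c")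
    case True
    then obtain c where "\<forall>i\<in>I. s i = c" ..
    then have "(\<Sum>i\<in>I. s i * d i) = c * sum d I"
      by (simp add: sum_distrib_left)
    with assms(2) show ?thesis by simp
  next
    case False
    define M where "M = Max (s ` I)"
    define M' where "M' = Max (s ` I - {M})"
    have "I \<noteq> {}" using False by auto
    then have M: "M \<in> s ` I" "\<And>i. i \<in> I \<Longrightarrow> s i \<le> M"
      using assms(1) by (auto simp: M_def)
    have ne: "s ` I - {M} \<noteq> {}" using False by blast
    then have M': "M' \<in> s ` I - {M}"
      unfolding M'_def using assms(1) by (intro Max_in) auto
    have M'_ge: "s i \<le> M'" if "i \<in> I" "s i \<noteq> M" for i
      unfolding M'_def using that assms(1) by (intro Max_ge) auto
    have "M' < M" using M' M(2) by force
    \<comment> \<open>Truncation at the second largest value \<open>M'\<close> merges the top two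
      levels; what is cut off is \<open>M - M'\<close> times the indicator of the top level
      set.\<close>
    define s' where "s' i = min (s i) M'" for i
    have "s' ` I \<subseteq> s ` I - {M}"
      using M' \<open>M' < M\<close> by (auto simp: s'_def min_def)
    then have "s' ` I \<subset> s ` I" using M(1) by blast
    then have card: "card (s' ` I) < card (s ` I)"
      using assms(1) by (simp add: psubset_card_mono)
    have "0 \<le> (\<Sum>i\<in>{i\<in>I. c \<le> s' i}. d i)" for c
    proof (cases "c \<le> M'")
      case True
      then have "{i\<in>I. c \<le> s' i} = {i\<in>I. c \<le> s i}" by (auto simp: s'_def)
      then show ?thesis using less.prems by simp
    next
      case False
      then have "{i\<in>I. c \<le> s' i} = {}" by (auto simp: s'_def)
      then show ?thesis by (simp only: sum.empty)
    qed
    then have "0 \<le> (\<Sum>i\<in>I. s' i * d i)"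
      using less.hyps[OF card] by blast
    moreover have "0 \<le> (M - M') * (\<Sum>i\<in>{i\<in>I. M \<le> s i}. d i)"
      using less.prems \<open>M' < M\<close> by simp
    moreover have "(\<Sum>i\<in>I. s i * d i)
        = (\<Sum>i\<in>I. s' i * d i) + (M - M') * (\<Sum>i\<in>{i\<in>I. M \<le> s i}. d i)"
    proof -
      have "s i * d i = s' i * d i + (M - M') * (if M \<le> s i then d i else 0)" if "i \<in> I" for i
        using M(2)[OF that] M'_ge[OF that] \<open>M' < M\<close>
        by (cases "s i = M") (auto simp: s'_def min_def algebra_simps)
      then have "(\<Sum>i\<in>I. s i * d i)
          = (\<Sum>i\<in>I. s' i * d i + (M - M') * (if M \<le> s i then d i else 0))"
        by (rule sum.cong[OF refl])
      also have "\<dots> = (\<Sum>i\<in>I. s' i * d i) + (M - M') * (\<Sum>i\<in>I. if M \<le> s i then d i else 0)"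
        by (simp only: sum.distrib sum_distrib_left)
      finally show ?thesis
        using assms(1) by (simp add: sum.inter_filter)
    qed
    ultimately show ?thesis by simp
  qed
qed

subsection \<open>Moving mass between two coordinates\<close>

definition move :: "real ^ 'n \<Rightarrow> 'n \<Rightarrow> 'n \<Rightarrow> real \<Rightarrow> real ^ ('n::finite)" where
  "move x i j \<epsilon> = x + \<epsilon> *\<^sub>R (axis i 1 - axis j 1)"

lemma move_nth:
  "move x i j \<epsilon> $ k = x $ k + \<epsilon> * (of_bool (k = i) - of_bool (k = j))"
  by (simp add: move_def axis_def)

lemma sum_move:
  "(\<Sum>k\<in>S. move x i j \<epsilon> $ k) = (\<Sum>k\<in>S. x $ k) + \<epsilon> * (of_bool (i \<in> S) - of_bool (j \<in> S))"
proof -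
  have "(\<Sum>k\<in>S. of_bool (k = l)) = (of_bool (l \<in> S) :: real)" for l
    by (simp add: of_bool_def)
  then show ?thesis
    by (simp add: move_nth sum.distrib sum_subtractf flip: sum_distrib_left)
qed

lemma eventually_at_right_less_bound:
  fixes a u :: real
  assumes "a < u"
  shows "\<forall>\<^sub>F \<epsilon> in at_right a. \<epsilon> < u"
  using eventually_at_right_real[OF assms] by eventually_elim simp

text \<open>Only a move entering \<open>S\<close> from outside raises the sum, so strict slack is
  asked for only then. The filter \<open>at_right 0\<close> combines finitely many smallness
  conditions without explicit thresholds.\<close>

lemma eventually_sum_move_le:
  assumes "(\<Sum>k\<in>S. x $ k) \<le> u"
    and "i \<in> S \<Longrightarrow> j \<notin> S \<Longrightarrow> (\<Sum>k\<in>S. x $ k) < u"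
  shows "\<forall>\<^sub>F \<epsilon> in at_right 0. (\<Sum>k\<in>S. move x i j \<epsilon> $ k) \<le> u"
proof (cases "i \<in> S \<and> j \<notin> S")
  case True
  with assms(2) have "0 < u - (\<Sum>k\<in>S. x $ k)" by simp
  from eventually_at_right_less_bound[OF this] show ?thesis
    by eventually_elim (use True in \<open>simp add: sum_move\<close>)
next
  case False
  from eventually_at_right_less[of "0::real"] show ?thesis
    by eventually_elim (use False assms(1) in \<open>auto simp: sum_move\<close>)
qed

lemma eventually_sum_move_ge:
  assumes "l \<le> (\<Sum>k\<in>S. x $ k)"
    and "j \<in> S \<Longrightarrow> i \<notin> S \<Longrightarrow> l < (\<Sum>k\<in>S. x $ k)"
  shows "\<forall>\<^sub>F \<epsilon> in at_right 0. l \<le> (\<Sum>k\<in>S. move x i j \<epsilon> $ k)"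
proof (cases "j \<in> S \<and> i \<notin> S")
  case True
  with assms(2) have "0 < (\<Sum>k\<in>S. x $ k) - l" by simp
  from eventually_at_right_less_bound[OF this] show ?thesis
    by eventually_elim (use True in \<open>simp add: sum_move\<close>)
next
  case False
  from eventually_at_right_less[of "0::real"] show ?thesis
    by eventually_elim (use False assms(1) in \<open>auto simp: sum_move\<close>)
qed

lemma objective_move:
  assumes "i \<noteq> j"
  shows "objective a b g (move x i j \<epsilon>) - objective a b g x
    = a $ i * g ((x $ i + \<epsilon>) / a $ i + b $ i) - a $ i * g (x $ i / a $ i + b $ i)
      + (a $ j * g ((x $ j - \<epsilon>) / a $ j + b $ j) - a $ j * g (x $ j / a $ j + b $ j))"
proof -
  define h where "h k = a $ k * g (move x i j \<epsilon> $ k / a $ k + b $ k)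
    - a $ k * g (x $ k / a $ k + b $ k)" for k
  have "objective a b g (move x i j \<epsilon>) - objective a b g x = sum h UNIV"
    by (simp add: objective_def h_def sum_subtractf)
  also have "\<dots> = sum h {i, j}"
    by (rule sum.mono_neutral_right) (auto simp: h_def move_nth)
  finally show ?thesis
    using assms by (simp add: h_def move_nth)
qed

text \<open>A small move puts both arguments strictly between \<open>p\<close> and \<open>q\<close>,
  where \<open>g\<close> lies strictly below its chord.\<close>

lemma eventually_objective_move_less:
  assumes g: "strictly_convex_on UNIV g"
    and a: "0 < a $ i" "0 < a $ j"
    and less: "x $ i / a $ i + b $ i < x $ j / a $ j + b $ j"
  shows "\<forall>\<^sub>F \<epsilon> in at_right 0. objective a b g (move x i j \<epsilon>) < objective a b g x"
proof -
  define p where "p = x $ i / a $ i + b $ i"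
  define q where "q = x $ j / a $ j + b $ j"
  define D where "D = q - p"
  have D: "0 < D" using less by (simp add: D_def p_def q_def)
  have "i \<noteq> j" using less by auto
  have conv: "g (v * p + w * q) < v * g p + w * g q" if "0 < v" "0 < w" "v + w = 1" for v w
    using g that D unfolding strictly_convex_on_def D_def by force
  have "0 < a $ i * D" "0 < a $ j * D" using a D by auto
  then have "\<forall>\<^sub>F \<epsilon> in at_right 0. \<epsilon> < a $ i * D" "\<forall>\<^sub>F \<epsilon> in at_right 0. \<epsilon> < a $ j * D"
    by (auto intro: eventually_at_right_less_bound)
  with eventually_at_right_less[of "0::real"] show ?thesis
  proof eventually_elim
    case (elim \<epsilon>)
    \<comment> \<open>\<open>v\<close> and \<open>w\<close> are the fractions of the gap
      \<open>D\<close> by which the two arguments are shifted.\<close>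
    define v where "v = \<epsilon> / (a $ i * D)"
    define w where "w = \<epsilon> / (a $ j * D)"
    have v: "0 < v" "v < 1" and w: "0 < w" "w < 1"
      using elim a D by (auto simp: v_def w_def)
    have "v * D = \<epsilon> / a $ i" "w * D = \<epsilon> / a $ j"
      using D by (auto simp: v_def w_def)
    then have args: "(x $ i + \<epsilon>) / a $ i + b $ i = (1 - v) * p + v * q"
      "(x $ j - \<epsilon>) / a $ j + b $ j = w * p + (1 - w) * q"
      by (simp_all add: D_def p_def q_def algebra_simps add_divide_distrib diff_divide_distrib)
    have "a $ i * g ((1 - v) * p + v * q) < a $ i * ((1 - v) * g p + v * g q)"
      "a $ j * g (w * p + (1 - w) * q) < a $ j * (w * g p + (1 - w) * g q)"
      using a v w conv[of "1 - v" v] conv[of w "1 - w"] by simp_all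
    moreover have "a $ i * v = \<epsilon> / D" "a $ j * w = \<epsilon> / D"
      using a by (simp_all add: v_def w_def)
    \<comment> \<open>Since \<open>a $ i * v = a $ j * w\<close>, the changes along the chord cancel
      between the two terms.\<close>
    then have "a $ i * ((1 - v) * g p + v * g q) + a $ j * (w * g p + (1 - w) * g q)
        = a $ i * g p + a $ j * g q"
      by algebra
    ultimately have "objective a b g (move x i j \<epsilon>) - objective a b g x < 0"
      unfolding objective_move[OF \<open>i \<noteq> j\<close>] args p_def[symmetric] q_def[symmetric] by linarith
    then show ?case by simp
  qed
qed

subsection \<open>Exchange in laminar families\<close>

text \<open>A set of sets instead of an indexed family, so that \<open>UNIV\<close> and singletons
  can be adjoined.\<close>

definition laminar :: "'a set set \<Rightarrow> bool" where
  "laminar F \<longleftrightarrow> (\<forall>S\<in>F. \<forall>T\<in>F. S \<inter> T \<noteq> {} \<longrightarrow> S \<subseteq> T \<or> T \<subseteq> S)"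

lemma laminar_subset: "laminar F \<Longrightarrow> G \<subseteq> F \<Longrightarrow> laminar G"
  unfolding laminar_def by blast

lemma laminar_insert_UNIV: "laminar F \<Longrightarrow> laminar (insert UNIV F)"
  unfolding laminar_def by blast

text \<open>Singletons turn box constraints into bounds on sums over members of the family.\<close>

lemma laminar_Un_singletons: "laminar F \<Longrightarrow> laminar (F \<union> range (\<lambda>i. {i}))"
  unfolding laminar_def by blast

text \<open>The inclusion-maximal members are pairwise disjoint and have the same union, so the sum
  splits over them.\<close>

lemma sum_Int_Union_laminar_nonneg:
  fixes w :: "'a \<Rightarrow> real"
  assumes "finite F" "\<And>T. T \<in> F \<Longrightarrow> finite T" "laminar F"
    and nonneg: "\<And>T. T \<in> F \<Longrightarrow> 0 \<le> sum w (A \<inter> T)"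
  shows "0 \<le> sum w (A \<inter> \<Union>F)"
proof -
  define G where "G = {T\<in>F. \<forall>S\<in>F. T \<subseteq> S \<longrightarrow> T = S}"
  have "\<exists>S\<in>G. T \<subseteq> S" if "T \<in> F" for T
    using finite_has_maximal2[OF assms(1) that] unfolding G_def by blast
  then have "\<Union>F = \<Union>G" unfolding G_def by blast
  then have "A \<inter> \<Union>F = (\<Union>T\<in>G. A \<inter> T)" by blast
  also have "sum w \<dots> = (\<Sum>T\<in>G. sum w (A \<inter> T))"
  proof (rule sum.UNION_disjoint)
    show "\<forall>S\<in>G. \<forall>T\<in>G. S \<noteq> T \<longrightarrow> A \<inter> S \<inter> (A \<inter> T) = {}"
    proof (intro ballI impI)
      fix S T assume "S \<in> G" "T \<in> G" "S \<noteq> T"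
      then have "S \<in> F" "T \<in> F" "\<not> S \<subseteq> T" "\<not> T \<subseteq> S" unfolding G_def by auto
      then have "S \<inter> T = {}" using assms(3) unfolding laminar_def by meson
      then show "A \<inter> S \<inter> (A \<inter> T) = {}" by blast
    qed
  qed (use assms(1,2) in \<open>auto simp: G_def\<close>)
  also have "0 \<le> \<dots>"
    by (rule sum_nonneg) (auto simp: G_def nonneg)
  finally show ?thesis .
qed

text \<open>Used with \<open>d\<close> the difference \<open>y - x\<close> of two feasible points:
  on each member separating \<open>i\<close> from \<open>j\<close>, moving mass from
  \<open>j\<close> to \<open>i\<close> changes the sum in the direction of \<open>y\<close>.\<close>

lemma laminar_exchange:
  fixes d :: "'a::finite \<Rightarrow> real"
  assumes lam: "laminar F" and total: "sum d UNIV = 0" and neg: "sum d A < 0"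
  obtains i j where "i \<notin> A" "j \<in> A"
    and "\<And>T. T \<in> F \<Longrightarrow> i \<in> T \<Longrightarrow> j \<notin> T \<Longrightarrow> 0 < sum d T"
    and "\<And>T. T \<in> F \<Longrightarrow> j \<in> T \<Longrightarrow> i \<notin> T \<Longrightarrow> sum d T < 0"
proof -
  have split: "sum d T = sum d (A \<inter> T) + sum d (- A \<inter> T)" for T
  proof -
    have "T = (A \<inter> T) \<union> (- A \<inter> T)" by blast
    then show ?thesis
      by (metis (no_types, lifting) Compl_disjoint finite inf.left_commute inf_assoc inf_bot_left
          inf_commute sum.union_disjoint)
  qed
  \<comment> \<open>Sets in which \<open>A\<close> loses mass and its complement gains;
    \<open>i\<close> and \<open>j\<close> are sought in a minimal one.\<close>
  define H where "H = {S \<in> insert UNIV F. sum d (A \<inter> S) < 0 \<and> 0 < sum d (- A \<inter> S)}"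
  have "UNIV \<in> H"
    using split[of UNIV] total neg by (simp add: H_def)
  then obtain S where S: "S \<in> H" and minimal: "\<And>T. T \<in> H \<Longrightarrow> T \<subseteq> S \<Longrightarrow> T = S"
    using finite_has_minimal[of H] by auto
  have lam': "laminar {T\<in>F. P T}" for P
    using lam by (rule laminar_subset) blast
  obtain j where j: "j \<in> A \<inter> S" "\<And>T. T \<in> F \<Longrightarrow> T \<subset> S \<Longrightarrow> j \<in> T \<Longrightarrow> sum d (A \<inter> T) < 0"
  proof -
    \<comment> \<open>Members inside \<open>S\<close> where \<open>A\<close> does not lose. On their
      union \<open>A\<close> does not lose either, so they cannot cover \<open>A \<inter> S\<close>,
      and \<open>j\<close> is chosen outside them; \<open>i\<close> is found symmetrically.\<close>
    define G where "G = {T\<in>F. T \<subset> S \<and> 0 \<le> sum d (A \<inter> T)}"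
    have "0 \<le> sum d (A \<inter> \<Union>G)"
      by (rule sum_Int_Union_laminar_nonneg) (auto simp: G_def lam')
    then have "A \<inter> \<Union>G \<noteq> A \<inter> S" using S by (auto simp: H_def)
    moreover have "\<Union>G \<subseteq> S" by (auto simp: G_def)
    ultimately obtain j where j: "j \<in> A \<inter> S" "j \<notin> \<Union>G" by blast
    show ?thesis
    proof (rule that)
      show "sum d (A \<inter> T) < 0" if "T \<in> F" "T \<subset> S" "j \<in> T" for T
        using j(2) that not_less unfolding G_def by blast
    qed (fact j(1))
  qed
  obtain i where i: "i \<in> - A \<inter> S" "\<And>T. T \<in> F \<Longrightarrow> T \<subset> S \<Longrightarrow> i \<in> T \<Longrightarrow> 0 < sum d (- A \<inter> T)"
  proof -
    define G where "G = {T\<in>F. T \<subset> S \<and> sum d (- A \<inter> T) \<le> 0}"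
    have "0 \<le> (\<Sum>k\<in>- A \<inter> \<Union>G. - d k)"
      by (rule sum_Int_Union_laminar_nonneg) (auto simp: G_def lam' sum_negf)
    then have "- A \<inter> \<Union>G \<noteq> - A \<inter> S" using S by (auto simp: H_def sum_negf)
    moreover have "\<Union>G \<subseteq> S" by (auto simp: G_def)
    ultimately obtain i where i: "i \<in> - A \<inter> S" "i \<notin> \<Union>G" by blast
    show ?thesis
    proof (rule that)
      show "0 < sum d (- A \<inter> T)" if "T \<in> F" "T \<subset> S" "i \<in> T" for T
        using i(2) that not_less unfolding G_def by blast
    qed (fact i(1))
  qed
  \<comment> \<open>Both \<open>i\<close> and \<open>j\<close> lie in \<open>S\<close>, so a member
    containing exactly one of them meets \<open>S\<close> without containing it.\<close>
  have below: "T \<subset> S" if "T \<in> F" "T \<inter> S \<noteq> {}" "\<not> S \<subseteq> T" for T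
    using laminar_insert_UNIV[OF lam] that S unfolding laminar_def H_def by blast
  \<comment> \<open>By minimality, in a proper submember where \<open>A\<close> loses the complement
    cannot gain, which fixes the sign of the whole sum; dually when the complement gains.\<close>
  have not_both: "\<not> (sum d (A \<inter> T) < 0 \<and> 0 < sum d (- A \<inter> T))" if "T \<in> F" "T \<subset> S" for T
    using minimal[of T] that unfolding H_def by blast
  show ?thesis
  proof (rule that)
    show "i \<notin> A" "j \<in> A" using i j by auto
    fix T assume T: "T \<in> F"
    show "0 < sum d T" if "i \<in> T" "j \<notin> T"
    proof -
      have "T \<subset> S" using below[OF T] that i(1) j(1) by blast
      then show ?thesis
        using i(2)[OF T] that(1) not_both[OF T] split[of T] by force
    qed
    show "sum d T < 0" if "j \<in> T" "i \<notin> T"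
    proof -
      have "T \<subset> S" using below[OF T] that i(1) j(1) by blast
      then show ?thesis
        using j(2)[OF T] that(1) not_both[OF T] split[of T] by force
    qed
  qed
qed

subsection \<open>Exchange for the constraint types\<close>

text \<open>Feasibility of all small amounts, not just of one, is what can be intersected with the
  strict decrease of the objective for small amounts.\<close>

definition exchange :: "(real ^ 'n \<Rightarrow> bool) \<Rightarrow> real ^ ('n::finite) \<Rightarrow> 'n set \<Rightarrow> bool" where
  "exchange P x A \<longleftrightarrow> (\<exists>i j. i \<notin> A \<and> j \<in> A \<and> (\<forall>\<^sub>F \<epsilon> in at_right 0. P (move x i j \<epsilon>)))"

lemma feasible_move_iff: "feasible R \<beta> x \<Longrightarrow> feasible R \<beta> (move x i j \<epsilon>) \<longleftrightarrow> satisfies \<beta> (move x i j \<epsilon>)"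
  by (simp add: feasible_def sum_move)

text \<open>The point \<open>y\<close> certifies slack: a sum strictly below that of
  \<open>y\<close> is strictly below \<open>u\<close>, and dually for \<open>l\<close>.\<close>

lemma eventually_bounds_move:
  assumes "l \<le> (\<Sum>k\<in>T. x $ k)" "(\<Sum>k\<in>T. x $ k) \<le> u"
    and "l \<le> (\<Sum>k\<in>T. y $ k)" "(\<Sum>k\<in>T. y $ k) \<le> u"
    and "i \<in> T \<Longrightarrow> j \<notin> T \<Longrightarrow> (\<Sum>k\<in>T. x $ k) < (\<Sum>k\<in>T. y $ k)"
    and "j \<in> T \<Longrightarrow> i \<notin> T \<Longrightarrow> (\<Sum>k\<in>T. y $ k) < (\<Sum>k\<in>T. x $ k)"
  shows "\<forall>\<^sub>F \<epsilon> in at_right 0. l \<le> (\<Sum>k\<in>T. move x i j \<epsilon> $ k) \<and> (\<Sum>k\<in>T. move x i j \<epsilon> $ k) \<le> u"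
  using assms
  by (intro eventually_conj eventually_sum_move_le eventually_sum_move_ge) force+

text \<open>The flag \<open>boxed\<close> lets one argument serve the types with box bounds and the
  laminar type without them.\<close>

lemma feasible_exchange_laminar:
  fixes x y :: "real ^ 'n"
  assumes x: "feasible R \<beta> x" and y: "feasible R \<beta> y"
    and less: "(\<Sum>i\<in>A. y $ i) < (\<Sum>i\<in>A. x $ i)"
    and lam: "laminar (N ` {1..m})"
    and satisfies_iff: "\<And>z. satisfies \<beta> z \<longleftrightarrow> (boxed \<longrightarrow> box_bounds l u z) \<and> group_bounds m N L U z"
  shows "exchange (feasible R \<beta>) x A"
proof -
  define F where "F = N ` {1..m} \<union> range (\<lambda>i. {i})"
  define d where "d k = y $ k - x $ k" for k
  have sum_d: "sum d T = (\<Sum>k\<in>T. y $ k) - (\<Sum>k\<in>T. x $ k)" for T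
    by (simp add: d_def sum_subtractf)
  have "sum d UNIV = 0" "sum d A < 0"
    using x y less by (auto simp: sum_d feasible_def)
  then obtain i j where ij: "i \<notin> A" "j \<in> A"
    and up: "\<And>T. T \<in> F \<Longrightarrow> i \<in> T \<Longrightarrow> j \<notin> T \<Longrightarrow> 0 < sum d T"
    and down: "\<And>T. T \<in> F \<Longrightarrow> j \<in> T \<Longrightarrow> i \<notin> T \<Longrightarrow> sum d T < 0"
    using laminar_exchange[of F d A] laminar_Un_singletons[OF lam] unfolding F_def by metis
  have bounds: "\<forall>\<^sub>F \<epsilon> in at_right 0.
      l' \<le> (\<Sum>k\<in>T. move x i j \<epsilon> $ k) \<and> (\<Sum>k\<in>T. move x i j \<epsilon> $ k) \<le> u'"
    if "T \<in> F" "l' \<le> (\<Sum>k\<in>T. x $ k)" "(\<Sum>k\<in>T. x $ k) \<le> u'"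
      "l' \<le> (\<Sum>k\<in>T. y $ k)" "(\<Sum>k\<in>T. y $ k) \<le> u'" for T l' u'
    using that up down by (intro eventually_bounds_move[of _ _ _ _ y]) (auto simp: sum_d)
  have "\<forall>\<^sub>F \<epsilon> in at_right 0. group_bounds m N L U (move x i j \<epsilon>)"
    unfolding group_bounds_def
    using x y by (intro eventually_ball_finite ballI bounds)
      (auto simp: feasible_def satisfies_iff group_bounds_def F_def)
  moreover have "\<forall>\<^sub>F \<epsilon> in at_right 0. boxed \<longrightarrow> box_bounds l u (move x i j \<epsilon>)"
  proof (cases boxed)
    case True
    have "\<forall>\<^sub>F \<epsilon> in at_right 0. l $ k \<le> move x i j \<epsilon> $ k \<and> move x i j \<epsilon> $ k \<le> u $ k" for k
      using bounds[of "{k}" "l $ k" "u $ k"] x y True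
      by (simp add: feasible_def satisfies_iff box_bounds_def F_def)
    then show ?thesis
      unfolding box_bounds_def by (simp add: True eventually_all_finite)
  qed simp
  ultimately have "\<forall>\<^sub>F \<epsilon> in at_right 0. feasible R \<beta> (move x i j \<epsilon>)"
    unfolding feasible_move_iff[OF x] satisfies_iff by eventually_elim blast
  with ij show ?thesis unfolding exchange_def by blast
qed

text \<open>At a point of the base polytope the tight sets are closed under union and intersection. If
  every move out of \<open>A\<close> is blocked by a tight set, the complement of \<open>A\<close> is a union of
  intersections of such sets and hence itself tight.\<close>

lemma feasible_exchange_SC:
  fixes x y :: "real ^ 'n"
  assumes adm: "admissible R (SC r)"
    and x: "feasible R (SC r) x" and y: "feasible R (SC r) y"
    and less: "(\<Sum>i\<in>A. y $ i) < (\<Sum>i\<in>A. x $ i)"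
  shows "exchange (feasible R (SC r)) x A"
proof -
  define tight where "tight S \<longleftrightarrow> (\<Sum>i\<in>S. x $ i) = r S" for S
  have le: "(\<Sum>i\<in>S. x $ i) \<le> r S" for S
    using x by (simp add: feasible_def)
  \<comment> \<open>Submodularity of \<open>r\<close> against modularity of the sum leaves no room
    in the two bounds from \<open>le\<close>.\<close>
  have tight_Un_Int: "tight (S \<union> T) \<and> tight (S \<inter> T)" if "tight S" "tight T" for S T
  proof -
    have "r (S \<union> T) + r (S \<inter> T) \<le> r S + r T"
      using adm by (simp add: submodular_def)
    moreover have "(\<Sum>i\<in>S \<union> T. x $ i) + (\<Sum>i\<in>S \<inter> T. x $ i) = (\<Sum>i\<in>S. x $ i) + (\<Sum>i\<in>T. x $ i)"
      by (rule sum.union_inter) auto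
    ultimately show ?thesis
      using that le[of "S \<union> T"] le[of "S \<inter> T"] unfolding tight_def by linarith
  qed
  \<comment> \<open>Base cases below: an empty intersection is \<open>UNIV\<close>, an empty union
    is \<open>{}\<close>.\<close>
  have tight_UNIV: "tight UNIV" and tight_empty: "tight {}"
    using adm x by (auto simp: tight_def feasible_def)
  have tight_INT: "tight (\<Inter>j\<in>J. T j)" if "\<And>j. j \<in> J \<Longrightarrow> tight (T j)" for J :: "'n set" and T
    using finite[of J] that by (induction J rule: finite_induct) (auto simp: tight_UNIV tight_Un_Int)
  have tight_UN: "tight (\<Union>j\<in>J. T j)" if "\<And>j. j \<in> J \<Longrightarrow> tight (T j)" for J :: "'n set" and T
    using finite[of J] that by (induction J rule: finite_induct) (auto simp: tight_empty tight_Un_Int)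
  have "\<exists>i j. i \<notin> A \<and> j \<in> A \<and> (\<forall>S. i \<in> S \<longrightarrow> j \<notin> S \<longrightarrow> \<not> tight S)"
  proof (rule ccontr)
    assume "\<not> ?thesis"
    then have "\<forall>i j. \<exists>S. i \<in> - A \<longrightarrow> j \<in> A \<longrightarrow> i \<in> S \<and> j \<notin> S \<and> tight S" by blast
    then obtain T where T: "\<And>i j. i \<in> - A \<Longrightarrow> j \<in> A \<Longrightarrow> i \<in> T i j \<and> j \<notin> T i j \<and> tight (T i j)"
      by metis
    have "tight (\<Union>i\<in>- A. \<Inter>j\<in>A. T i j)"
      using T by (intro tight_UN tight_INT) blast
    moreover have "(\<Union>i\<in>- A. \<Inter>j\<in>A. T i j) = - A"
    proof
      show "(\<Union>i\<in>- A. \<Inter>j\<in>A. T i j) \<subseteq> - A" using T by blast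
      show "- A \<subseteq> (\<Union>i\<in>- A. \<Inter>j\<in>A. T i j)" using T by blast
    qed
    \<comment> \<open>Tightness gives \<open>x\<close> the largest possible mass on
      \<open>- A\<close>, hence, the total being \<open>R\<close>, the least on \<open>A\<close>,
      against \<open>less\<close>.\<close>
    ultimately have "(\<Sum>i\<in>- A. x $ i) = r (- A)" by (simp add: tight_def)
    moreover have "(\<Sum>i\<in>- A. y $ i) \<le> r (- A)" using y by (simp add: feasible_def)
    moreover have "(\<Sum>i\<in>- A. z $ i) = R - (\<Sum>i\<in>A. z $ i)" if "feasible R (SC r) z" for z
      using that sum_diff[of UNIV A "\<lambda>i. z $ i"] by (simp add: feasible_def Compl_eq_Diff_UNIV)
    ultimately show False using x y less by fastforce
  qed
  then obtain i j where ij: "i \<notin> A" "j \<in> A"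
    and slack: "\<And>S. i \<in> S \<Longrightarrow> j \<notin> S \<Longrightarrow> (\<Sum>k\<in>S. x $ k) < r S"
    using le unfolding tight_def by (metis order_le_less)
  have "\<forall>\<^sub>F \<epsilon> in at_right 0. \<forall>S. (\<Sum>k\<in>S. move x i j \<epsilon> $ k) \<le> r S"
    using le slack by (intro eventually_all_finite eventually_sum_move_le) auto
  then have "\<forall>\<^sub>F \<epsilon> in at_right 0. feasible R (SC r) (move x i j \<epsilon>)"
    by eventually_elim (use x in \<open>simp add: feasible_def sum_move\<close>)
  with ij show ?thesis unfolding exchange_def by blast
qed

section \<open>Reduction of partition, nested and laminar constraints to laminar sets of
  sets\<close>

lemma laminar_partition_family: "partition_family m N \<Longrightarrow> laminar (N ` {1..m})"
  unfolding partition_family_def partition_on_def disjoint_def laminar_def by blast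

lemma laminar_laminar_family: "laminar_family m N \<Longrightarrow> laminar (N ` {1..m})"
  unfolding laminar_family_def laminar_def by blast

lemma laminar_nested_family:
  assumes "nested_family m N"
  shows "laminar (N ` {1..m})"
proof -
  have mono: "N j \<subseteq> N k" if "j \<le> k" "1 \<le> j" "k \<le> m" for j k
    using that
  proof (induction rule: dec_induct)
    case (step k)
    then have "N k \<subseteq> N (Suc k)" using assms by (auto simp: nested_family_def)
    with step show ?case by auto
  qed simp
  show ?thesis
    unfolding laminar_def
  proof (intro ballI impI)
    fix S T assume "S \<in> N ` {1..m}" "T \<in> N ` {1..m}"
    then obtain j k where "S = N j" "T = N k" "j \<in> {1..m}" "k \<in> {1..m}" by blast
    then show "S \<subseteq> T \<or> T \<subseteq> S" using mono[of j k] mono[of k j] by (cases "j \<le> k") auto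
  qed
qed

lemma feasible_exchange:
  fixes x y :: "real ^ 'n"
  assumes "admissible R \<beta>" "feasible R \<beta> x" "feasible R \<beta> y"
    and "(\<Sum>i\<in>A. y $ i) < (\<Sum>i\<in>A. x $ i)"
  shows "exchange (feasible R \<beta>) x A"
proof (cases \<beta>)
  case (Box l u)
  \<comment> \<open>With \<open>m = 0\<close> the index range \<open>{1..m}\<close> is empty, so
    only the box bounds remain.\<close>
  show ?thesis
    by (rule feasible_exchange_laminar[OF assms(2-4), where m = 0 and boxed = True])
      (auto simp: Box laminar_def group_bounds_def)
next
  case (GBC l u m N L U)
  show ?thesis
    by (rule feasible_exchange_laminar[OF assms(2-4), where m = m and N = N and boxed = True])
      (use assms(1) laminar_partition_family[of m N] in \<open>auto simp: GBC\<close>)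
next
  case (NC l u m N L U)
  show ?thesis
    by (rule feasible_exchange_laminar[OF assms(2-4), where m = m and N = N and boxed = True])
      (use assms(1) laminar_nested_family[of m N] in \<open>auto simp: NC\<close>)
next
  case (LC m N L U)
  show ?thesis
    by (rule feasible_exchange_laminar[OF assms(2-4), where m = m and N = N and boxed = False])
      (use assms(1) laminar_laminar_family[of m N] in \<open>auto simp: LC\<close>)
next
  case (SC r)
  show ?thesis
    using assms feasible_exchange_SC unfolding SC by blast
qed

section \<open>Transfer of optimality through exchange on level sets\<close>

theorem corollary3:
  fixes a b x :: "real ^ 'n"
    and R :: real
    and \<beta> :: "'n constraints"
    and fbar f :: "real \<Rightarrow> real"
  assumes "\<And>i. a $ i > 0"
    and "admissible R \<beta>"
    and "strictly_convex_on UNIV fbar"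
    and "convex_on UNIV f"
    and "optimal a b fbar R \<beta> x"
  shows "optimal a b f R \<beta> x"
proof -
  define t where "t z i = z $ i / a $ i + b $ i" for z i
  have x: "feasible R \<beta> x"
    and opt: "\<And>z. feasible R \<beta> z \<Longrightarrow> \<not> objective a b fbar z < objective a b fbar x"
    using assms(5) by (auto simp: optimal_def is_arg_min_def)
  obtain \<sigma> where \<sigma>: "mono \<sigma>" "\<And>t u. f t + \<sigma> t * (u - t) \<le> f u"
    using convex_on_UNIV_subgradient[OF assms(4)] by metis
  \<comment> \<open>Feasibility and strict improvement would both hold for all small amounts; since
    \<open>at_right 0\<close> is a proper filter, some feasible point would beat
    \<open>x\<close>.\<close>
  have no_move: False
    if "t x i < t x j" "\<forall>\<^sub>F \<epsilon> in at_right 0. feasible R \<beta> (move x i j \<epsilon>)" for i j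
  proof -
    have "\<forall>\<^sub>F \<epsilon> in at_right 0. objective a b fbar (move x i j \<epsilon>) < objective a b fbar x"
      by (rule eventually_objective_move_less) (use assms(1,3) that(1) in \<open>auto simp: t_def\<close>)
    with that(2) have "\<forall>\<^sub>F \<epsilon> in at_right (0::real). False"
      by eventually_elim (use opt in blast)
    then show False by simp
  qed
  have "objective a b f x \<le> objective a b f y" if y: "feasible R \<beta> y" for y
  proof -
    \<comment> \<open>The linearised change of the objective for \<open>f\<close> from
      \<open>x\<close> to \<open>y\<close>, summed over levels of
      \<open>\<sigma> (t x i)\<close>.\<close>
    have "0 \<le> (\<Sum>i\<in>UNIV. \<sigma> (t x i) * (y $ i - x $ i))"
    proof (rule sum_mult_nonneg_if_upper_levels)
      show "(\<Sum>i\<in>UNIV. y $ i - x $ i) = 0"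
        using x y by (simp add: feasible_def sum_subtractf)
      fix c
      define A where "A = {i \<in> UNIV. c \<le> \<sigma> (t x i)}"
      \<comment> \<open>\<open>\<sigma>\<close> may be constant on intervals, but points separated
        by a level of \<open>\<sigma>\<close> have strictly ordered arguments.\<close>
      have "t x i < t x j" if "i \<notin> A" "j \<in> A" for i j
      proof (rule ccontr)
        assume "\<not> ?thesis"
        then have "\<sigma> (t x j) \<le> \<sigma> (t x i)" using \<sigma>(1) by (simp add: monoD)
        with that show False by (simp add: A_def)
      qed
      then have "\<not> exchange (feasible R \<beta>) x A"
        using no_move unfolding exchange_def by blast
      then have "(\<Sum>i\<in>A. x $ i) \<le> (\<Sum>i\<in>A. y $ i)"
        using feasible_exchange[OF assms(2) x y] by force
      then show "0 \<le> (\<Sum>i\<in>A. y $ i - x $ i)"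
        by (simp add: sum_subtractf)
    qed simp
    also have "\<dots> \<le> (\<Sum>i\<in>UNIV. a $ i * f (t y i) - a $ i * f (t x i))"
    proof (rule sum_mono)
      fix i
      \<comment> \<open>The outer weight \<open>a $ i\<close> cancels the inner slope
        \<open>1 / a $ i\<close>, so the subgradient inequality for \<open>f\<close> bounds the
        linear term.\<close>
      have "a $ i * (t y i - t x i) = y $ i - x $ i"
        using assms(1)[of i] by (simp add: t_def field_simps)
      then have "\<sigma> (t x i) * (y $ i - x $ i) = a $ i * (\<sigma> (t x i) * (t y i - t x i))"
        by (metis mult.left_commute)
      also have "\<dots> \<le> a $ i * (f (t y i) - f (t x i))"
        using assms(1)[of i] \<sigma>(2)[of "t x i" "t y i"] by (intro mult_left_mono) auto
      finally show "\<sigma> (t x i) * (y $ i - x $ i) \<le> a $ i * f (t y i) - a $ i * f (t x i)"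
        by (simp add: right_diff_distrib)
    qed
    finally show ?thesis
      by (simp add: objective_def t_def sum_subtractf)
  qed
  with x show ?thesis
    by (force simp: optimal_def is_arg_min_def)
qed

end
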